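(* The following statements hold. (1) $P_4\cap\mathcal R_1=\emptyset$. (2) If $(\omega,\omega',\mathbf v)\in X\smallsetminus(P_4\cup \mathit{NUC})$, then there are integers $m<0$ and $n>0$ for which $\Phi^m(\omega,\omega',\mathbf v)\in\mathcal R_1$ and $\Phi^n(\omega,\omega',\mathbf v)\in\mathcal R_1$. In particular, the first return map $\Phi_R:\mathcal R_1\to\mathcal R_1$ of $\Phi$ to $\mathcal R_1$ is well defined and invertible. (3) If $(\omega,\omega',\mathbf v)\in\mathcal R_1$, then $\rho\circ\Phi_R(\omega,\omega',\mathbf v)=\Phi\circ\rho(\omega,\omega',\mathbf v)$. (4) If $(\omega,\omega',\mathbf v)\in\mathcal R_1$ has a stable periodic orbit of period larger than four, then $\rho(\omega,\omega',\mathbf v)$ has a stable periodic orbit of strictly smaller period.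
   Context: $\Omega_\pm=\{\pm1\}^{\mathbb Z}$ with the product topology, $\sigma(\omega)_n=\omega_{n+1}$, $N=\{(1,0),(0,1),(-1,0),(0,-1)\}$, $X=\Omega_\pm\times\Omega_\pm\times N$. The map $\Phi:X\to X$ is the bijection $$\Phi(\omega,\omega',(a,b))=(\sigma^{sb}(\omega),\sigma^{sa}(\omega'),s(b,a)),\qquad s=\omega_0\omega'_0 .$$ Stable periodic orbits: a point $(\omega,\omega',\mathbf v)\in X$ has a stable periodic orbit of period $n$ if $n$ is the smallest positive integer for which there are open neighborhoods $U$ of $\omega$ and $U'$ of $\omega'$ such that $\Phi^n(\eta,\eta',\mathbf v)=(\eta,\eta',\mathbf v)$ for all $(\eta,\eta')\in U\times U'$. $P_4$ is the set of points of $X$ with a stable periodic orbit of period $4$. Collapsing map: let $S=\{\omega:\omega_0=-1,\omega_1=1\}\cup\{\omega:\omega_{-1}=-1,\omega_0=1\}\subset\Omega_\pm$ and $K(\omega)=\{k\in\mathbb Z:\sigma^k(\omega)\notin S\}$. The sequence $\omega$ is unbounded-collapsible if $K(\omega)$ is unbounded above and below, zero-collapsible if $0\in K(\omega)$, and collapsible if both hold. $C$ is the set of collapsible elements. For $\omega\in C$, index $K(\omega)=\{k_i:i\in\mathbb Z\}$ increasingly with $k_0=0$ and define $c(\omega)\in\Omega_\pm$ by $c(\omega)_i=\omega_{k_i}$. $\mathcal R_1=C\times C\times N$, and $\rho:\mathcal R_1\to X$ is $\rho(\omega,\omega',\mathbf v)=(c(\omega),c(\omega'),\mathbf v)$. $\mathit{NUC}$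 is the set of $(\omega,\omega',\mathbf v)\in X$ such that $\omega$ or $\omega'$ is not unbounded-collapsible. The first return map is $\Phi_R(x)=\Phi^n(x)$ with $n$ the least positive integer such that $\Phi^n(x)\in\mathcal R_1$. *)

theory Defs
  imports "HOL-Analysis.Analysis"
begin

type_synonym seq = "int \<Rightarrow> int"
type_synonym point = "seq \<times> seq \<times> (int \<times> int)"

definition Omega_top :: "seq topology" where
  "Omega_top = product_topology (\<lambda>_. discrete_topology {-1, 1}) UNIV"

definition Omega :: "seq set" where
  "Omega = topspace Omega_top"

definition shift :: "seq \<Rightarrow> seq" where
  "shift w = (\<lambda>n. w (n + 1))"

text \<open>Integer powers of a bijection of \<open>A\<close> onto itself.\<close>

definition int_iter :: "'a set \<Rightarrow> ('a \<Rightarrow> 'a) \<Rightarrow> int \<Rightarrow> 'a \<Rightarrow> 'a" where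
  "int_iter A f k = (if 0 \<le> k then f ^^ nat k else inv_into A f ^^ nat (- k))"

abbreviation shift_pow :: "int \<Rightarrow> seq \<Rightarrow> seq" where
  "shift_pow \<equiv> int_iter Omega shift"

definition N :: "(int \<times> int) set" where
  "N = {(1, 0), (0, 1), (-1, 0), (0, -1)}"

definition X :: "point set" where
  "X = Omega \<times> Omega \<times> N"

fun Phi :: "point \<Rightarrow> point" where
  "Phi (w, w', (a, b)) =
    (let s = w 0 * w' 0 in (shift_pow (s * b) w, shift_pow (s * a) w', (s * b, s * a)))"

abbreviation Phi_pow :: "int \<Rightarrow> point \<Rightarrow> point" where
  "Phi_pow \<equiv> int_iter X Phi"

fun locally_fixed :: "nat \<Rightarrow> point \<Rightarrow> bool" where
  "locally_fixed n (w, w', v) \<longleftrightarrow>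
    (\<exists>U U'. openin Omega_top U \<and> w \<in> U \<and> openin Omega_top U' \<and> w' \<in> U' \<and>
      (\<forall>e\<in>U. \<forall>e'\<in>U'. (Phi ^^ n) (e, e', v) = (e, e', v)))"

definition stable_period :: "point \<Rightarrow> nat \<Rightarrow> bool" where
  "stable_period x n \<longleftrightarrow> x \<in> X \<and> 0 < n \<and> locally_fixed n x \<and>
    (\<forall>m. 0 < m \<and> m < n \<longrightarrow> \<not> locally_fixed m x)"

definition P4 :: "point set" where
  "P4 = {x \<in> X. stable_period x 4}"

definition S :: "seq set" where
  "S = {w \<in> Omega. w 0 = -1 \<and> w 1 = 1} \<union> {w \<in> Omega. w (-1) = -1 \<and> w 0 = 1}"

definition K :: "seq \<Rightarrow> int set" where
  "K w = {k. shift_pow k w \<notin> S}"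

definition unbounded_collapsible :: "seq \<Rightarrow> bool" where
  "unbounded_collapsible w \<longleftrightarrow> \<not> bdd_above (K w) \<and> \<not> bdd_below (K w)"

definition zero_collapsible :: "seq \<Rightarrow> bool" where
  "zero_collapsible w \<longleftrightarrow> 0 \<in> K w"

definition C :: "seq set" where
  "C = {w \<in> Omega. unbounded_collapsible w \<and> zero_collapsible w}"

definition K_index :: "seq \<Rightarrow> int \<Rightarrow> int" where
  "K_index w = (THE k. strict_mono k \<and> range k = K w \<and> k 0 = 0)"

definition collapse :: "seq \<Rightarrow> seq" where
  "collapse w = (\<lambda>i. w (K_index w i))"

definition R1 :: "point set" where
  "R1 = C \<times> C \<times> N"

fun rho :: "point \<Rightarrow> point" where
  "rho (w, w', v) = (collapse w, collapse w', v)"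

definition NUC :: "point set" where
  "NUC = {(w, w', v) \<in> X. \<not> unbounded_collapsible w \<or> \<not> unbounded_collapsible w'}"

definition Phi_R :: "point \<Rightarrow> point" where
  "Phi_R x = (Phi ^^ (LEAST n. 0 < n \<and> (Phi ^^ n) x \<in> R1)) x"

text \<open>The maps whose negative powers are used are bijections of the carriers in question.\<close>

lemma Omega_iff: "w \<in> Omega \<longleftrightarrow> (\<forall>n. w n = -1 \<or> w n = 1)"
  by (auto simp: Omega_def Omega_top_def PiE_iff)

lemma bij_betw_shift: "bij_betw shift Omega Omega"
  by (rule bij_betw_byWitness[where f' = "\<lambda>w n. w (n - 1)"])
    (auto simp: shift_def Omega_iff)

lemma inv_shift:
  assumes "w \<in> Omega"
  shows "inv_into Omega shift w = (\<lambda>n. w (n - 1))"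
proof -
  have "(\<lambda>n. w (n - 1)) \<in> Omega" "shift (\<lambda>n. w (n - 1)) = w"
    using assms by (auto simp: shift_def Omega_iff)
  then show ?thesis
    using bij_betw_shift by (metis bij_betw_def inv_into_f_f)
qed

lemma shift_pow_eq:
  assumes "w \<in> Omega"
  shows "shift_pow k w = (\<lambda>n. w (n + k))"
proof -
  have pos: "(shift ^^ i) w = (\<lambda>n. w (n + int i))" for i
    by (induction i) (auto simp: shift_def algebra_simps)
  have neg: "(inv_into Omega shift ^^ i) w = (\<lambda>n. w (n - int i))" for i
  proof (induction i)
    case (Suc i)
    have "(\<lambda>n. w (n - int i)) \<in> Omega"
      using assms by (auto simp: Omega_iff)
    with Suc show ?case
      by (simp add: inv_shift algebra_simps)
  qed simp
  show ?thesis
    by (simp add: int_iter_def pos neg)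
qed

lemma bij_betw_Phi: "bij_betw Phi X X"
proof (rule bij_betw_byWitness[where f' = "\<lambda>(w, w', (c, d)).
    let s = w (- c) * w' (- d) in ((\<lambda>n. w (n - c)), (\<lambda>n. w' (n - d)), (s * d, s * c))"])
  have sq: "w n * w n = 1" if "w \<in> Omega" for w n
    using that by (metis Omega_iff minus_mult_minus mult_1)
  have sq4: "w n * (w' m * (w n * (w' m * a))) = a" if "w \<in> Omega" "w' \<in> Omega" for w w' n m a
    using sq[OF that(1), of n] sq[OF that(2), of m]
    by (metis mult.assoc mult.left_commute mult_1)
  have sh: "(\<lambda>n. w (n + k)) \<in> Omega" "(\<lambda>n. w (n - k)) \<in> Omega" if "w \<in> Omega" for w k
    using that by (auto simp: Omega_iff)
  have val: "w n * w' m = 1 \<or> w n * w' m = -1" if "w \<in> Omega" "w' \<in> Omega" for w w' n m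
    using that by (metis Omega_iff minus_mult_minus mult_1 mult_minus1_right mult_1_right)
  have N_closed: "(s * b, s * a) \<in> N" if "s = 1 \<or> s = -1" "(a, b) \<in> N" for s a b
    using that by (auto simp: N_def)
  let ?g = "\<lambda>(w, w', (c, d)). let s = w (- c) * w' (- d) in
    ((\<lambda>n. w (n - c)), (\<lambda>n. w' (n - d)), (s * d, s * c)) :: point"
  show "\<forall>x\<in>X. ?g (Phi x) = x"
    by (auto simp: X_def Let_def shift_pow_eq mult.assoc sq4)
  show "\<forall>x\<in>X. Phi (?g x) = x"
    by (auto simp: X_def Let_def shift_pow_eq sh mult.assoc sq4)
  show "Phi ` X \<subseteq> X"
    using N_closed val by (auto simp: X_def Let_def shift_pow_eq sh)
  show "?g ` X \<subseteq> X"
    using N_closed val by (auto simp: X_def Let_def sh)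
qed

end

theory Submission
  imports Defs
begin

text \<open>
  Fix the two sequences and let the point move instead: \<open>\<Phi>\<close> becomes a walk on
  \<open>\<int>\<^sup>2 \<times> N\<close>, and a point has a stable periodic orbit of period \<open>n\<close> iff its walk first
  closes up after \<open>n\<close> steps, since a translation under which all sequences near a given one are
  invariant is trivial. At \<open>(x, y)\<close> the walk turns between the directions \<open>(e u'(y), 0)\<close> and
  \<open>(0, e u(x))\<close>, where the sign \<open>e\<close> never changes; so it alternates the shears
  \<open>y \<mapsto> y + e u(x)\<close> and \<open>x \<mapsto> x + e u'(y)\<close>, and reversing time replaces \<open>e\<close> by \<open>- e\<close>.

  Collapsing deletes the disjoint pairs of columns (rows) carrying the signs \<open>-+\<close>. A walk that
  enters a deleted pair of columns along a row which is not deleted crosses the pair in four steps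
  and leaves along the same row, so the first return to the undeleted positions is the walk of the
  collapsed sequences. Adjacent deleted positions carry opposite signs, which forces a walk
  that only meets deleted rows and columns to be a loop of length four.

  Finally, a walk confined to undeleted positions keeps its directions for ever, forwards or
  backwards in time according to the sign \<open>e u(x) u'(y)\<close> at any one of its positions. So it drifts
  to infinity and never closes up; hence a closed walk meets a deleted position and collapsing
  shortens it.
\<close>

subsection \<open>First return maps\<close>

definition first_return :: "('a \<Rightarrow> 'a) \<Rightarrow> 'a set \<Rightarrow> 'a \<Rightarrow> 'a" where
  "first_return f A x = (f ^^ (LEAST n. 0 < n \<and> (f ^^ n) x \<in> A)) x"

lemma funpow_add_apply: "(f ^^ (m + n)) x = (f ^^ m) ((f ^^ n) x)"
  by (simp add: funpow_add)

lemma first_return_eqI: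
  assumes "0 < n" "(f ^^ n) x \<in> A" "\<And>j. 0 < j \<Longrightarrow> j < n \<Longrightarrow> (f ^^ j) x \<notin> A"
  shows "first_return f A x = (f ^^ n) x"
proof -
  have "(LEAST n. 0 < n \<and> (f ^^ n) x \<in> A) = n"
    by (rule Least_equality) (use assms in \<open>auto simp flip: not_less\<close>)
  then show ?thesis by (simp add: first_return_def)
qed

lemma first_returnE:
  assumes "0 < m" "(f ^^ m) x \<in> A"
  obtains n where "0 < n" "n \<le> m" "(f ^^ n) x \<in> A" "first_return f A x = (f ^^ n) x"
    "\<And>j. 0 < j \<Longrightarrow> j < n \<Longrightarrow> (f ^^ j) x \<notin> A"
proof -
  let ?returns = "\<lambda>n. 0 < n \<and> (f ^^ n) x \<in> A"
  have "?returns (LEAST n. ?returns n)" by (rule LeastI[of ?returns m]) (use assms in auto)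
  moreover have "(LEAST n. ?returns n) \<le> m" by (rule Least_le) (use assms in auto)
  moreover have "(f ^^ j) x \<notin> A" if "0 < j" "j < (LEAST n. ?returns n)" for j
    using not_less_Least[of j ?returns] that by auto
  ultimately show thesis using that by (auto simp: first_return_def)
qed

lemma first_return_in: "\<exists>n>0. (f ^^ n) x \<in> A \<Longrightarrow> first_return f A x \<in> A"
  by (metis first_returnE)

lemma inj_on_first_return:
  assumes "bij_betw f B B" "A \<subseteq> B" and returns: "\<And>x. x \<in> A \<Longrightarrow> \<exists>n>0. (f ^^ n) x \<in> A"
  shows "inj_on (first_return f A) A"
proof (rule inj_onI)
  have same_origin: "x = y"
    if "x \<in> A" "y \<in> A" "0 < r" "r \<le> s" "(f ^^ r) x = (f ^^ s) y"
      and avoids: "\<And>j. 0 < j \<Longrightarrow> j < s \<Longrightarrow> (f ^^ j) y \<notin> A" for x y r s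
  proof -
    have "inj_on (f ^^ r) B" "(f ^^ (s - r)) y \<in> B"
      using bij_betw_funpow[OF assms(1)] \<open>A \<subseteq> B\<close> \<open>y \<in> A\<close>
      by (auto dest: bij_betw_imp_inj_on bij_betwE)
    moreover have "(f ^^ r) x = (f ^^ r) ((f ^^ (s - r)) y)"
      using that(4,5) by (simp flip: funpow_add_apply)
    ultimately have "x = (f ^^ (s - r)) y"
      using \<open>A \<subseteq> B\<close> \<open>x \<in> A\<close> by (auto dest: inj_onD)
    then show "x = y" using avoids[of "s - r"] that(1,3,4) by (cases "r = s") auto
  qed
  fix x y assume xy: "x \<in> A" "y \<in> A" "first_return f A x = first_return f A y"
  obtain r where "0 < r" "first_return f A x = (f ^^ r) x"
    "\<And>j. 0 < j \<Longrightarrow> j < r \<Longrightarrow> (f ^^ j) x \<notin> A" using returns[OF xy(1)] by (metis first_returnE)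
  moreover obtain s where "0 < s" "first_return f A y = (f ^^ s) y"
    "\<And>j. 0 < j \<Longrightarrow> j < s \<Longrightarrow> (f ^^ j) y \<notin> A" using returns[OF xy(2)] by (metis first_returnE)
  ultimately show "x = y"
    using same_origin[of x y r s] same_origin[of y x s r] xy by (cases "r \<le> s") auto
qed

lemma first_return_preimage:
  assumes "y \<in> A" "\<exists>n>0. \<exists>x\<in>A. (f ^^ n) x = y"
  shows "\<exists>x\<in>A. first_return f A x = y"
proof -
  let ?reaches = "\<lambda>n. 0 < n \<and> (\<exists>x\<in>A. (f ^^ n) x = y)"
  define n where "n = (LEAST n. ?reaches n)"
  have "?reaches n" unfolding n_def using assms(2) by (rule LeastI_ex)
  then obtain x where x: "x \<in> A" "(f ^^ n) x = y" "0 < n" by blast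
  have "(f ^^ j) x \<notin> A" if "0 < j" "j < n" for j
  proof
    assume "(f ^^ j) x \<in> A"
    moreover have "(f ^^ (n - j)) ((f ^^ j) x) = y"
      using x that by (simp flip: funpow_add_apply)
    ultimately have "?reaches (n - j)" using that by auto
    then have "n \<le> n - j" unfolding n_def by (rule Least_le)
    then show False using that by simp
  qed
  then have "first_return f A x = y" using first_return_eqI x \<open>y \<in> A\<close> by metis
  then show ?thesis using x by blast
qed

lemma bij_betw_first_return:
  assumes "bij_betw f B B" "A \<subseteq> B"
    and "\<And>x. x \<in> A \<Longrightarrow> \<exists>n>0. (f ^^ n) x \<in> A"
    and "\<And>y. y \<in> A \<Longrightarrow> \<exists>n>0. \<exists>x\<in>A. (f ^^ n) x = y"
  shows "bij_betw (first_return f A) A A"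
proof (rule bij_betw_imageI)
  show "inj_on (first_return f A) A" using assms by (intro inj_on_first_return)
  have "first_return f A x \<in> A" if "x \<in> A" for x
    using first_return_in assms(3) that by metis
  then have "first_return f A ` A \<subseteq> A" by (rule image_subsetI)
  moreover have "y \<in> first_return f A ` A" if "y \<in> A" for y
    using first_return_preimage[OF that assms(4)[OF that]] by auto
  then have "A \<subseteq> first_return f A ` A" by (rule subsetI)
  ultimately show "first_return f A ` A = A" by (rule equalityI)
qed

lemma first_return_funpow_card_visits:
  assumes "(f ^^ n) x \<in> A"
  shows "(first_return f A ^^ card {j \<in> {0<..n}. (f ^^ j) x \<in> A}) x = (f ^^ n) x"
  using assms
proof (induction n arbitrary: x rule: less_induct)
  case (less n)
  let ?visits = "\<lambda>x n. {j \<in> {0<..n}. (f ^^ j) x \<in> A}"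
  show ?case
  proof (cases "n = 0")
    case False
    then obtain r where r: "0 < r" "r \<le> n" "(f ^^ r) x \<in> A" "first_return f A x = (f ^^ r) x"
      "\<And>j. 0 < j \<Longrightarrow> j < r \<Longrightarrow> (f ^^ j) x \<notin> A"
      using first_returnE[of n f x A] less.prems by blast
    let ?x = "(f ^^ r) x"
    have shift: "(f ^^ (n - r)) ?x = (f ^^ n) x"
      using r(2) by (simp flip: funpow_add_apply)
    have "?visits x n = insert r ((\<lambda>j. j + r) ` ?visits ?x (n - r))"
    proof (intro set_eqI iffI)
      fix j assume j: "j \<in> ?visits x n"
      then have "r \<le> j" using r(5) by (metis greaterThanAtMost_iff mem_Collect_eq not_le)
      then show "j \<in> insert r ((\<lambda>j. j + r) ` ?visits ?x (n - r))"
        using j by (cases "j = r") (auto simp flip: funpow_add_apply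
            intro!: image_eqI[of _ _ "j - r"])
    qed (use r in \<open>auto simp: funpow_add_apply\<close>)
    moreover have "r \<notin> (\<lambda>j. j + r) ` ?visits ?x (n - r)" by auto
    ultimately have "card (?visits x n) = Suc (card (?visits ?x (n - r)))"
      by (simp add: card_image)
    then show ?thesis
      using less.IH[of "n - r" ?x] less.prems r shift
      by (simp add: funpow_Suc_right del: funpow.simps)
  qed simp
qed

lemma first_return_closed_orbit:
  assumes "x \<in> A" "0 < n" "(f ^^ n) x = x" "(f ^^ i) x \<notin> A"
  shows "\<exists>m. 0 < m \<and> m < n \<and> (first_return f A ^^ m) x = x"
proof (intro exI conjI)
  let ?visits = "{j \<in> {0<..n}. (f ^^ j) x \<in> A}"
  have "(f ^^ (i mod n)) x \<notin> A" using funpow_mod_eq[OF assms(3)] assms(4) by simp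
  moreover from this have "0 < i mod n" using assms(1) by (intro gr0I) auto
  ultimately have "i mod n \<in> {0<..n} - ?visits" using \<open>0 < n\<close> by (auto simp: less_imp_le)
  then have "card ?visits < card {0<..n}" by (intro psubset_card_mono) (simp, blast)
  then show "card ?visits < n" by simp
  have "n \<in> ?visits" using assms by simp
  then show "0 < card ?visits" by (auto simp: card_gt_0_iff)
  show "(first_return f A ^^ card ?visits) x = x"
    using first_return_funpow_card_visits[of n f x A] assms by simp
qed

subsection \<open>Unbounded sets of integers\<close>

lemma funpow_plus: "((+) a ^^ n) x = x + a * int n" for a x :: int
  by (induction n) (auto simp: algebra_simps)

lemma unbounded_int_set_meets_ray:
  fixes A :: "int set"
  assumes "\<not> bdd_above A" "\<not> bdd_below A" "a \<in> {-1, 1}"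
  shows "\<exists>n>0. ((+) a ^^ n) x \<in> A"
proof -
  have "\<exists>z\<in>A. 0 < a * (z - x)"
    using assms by (auto simp: bdd_above_def bdd_below_def not_le)
  then obtain z where "z \<in> A" "0 < a * (z - x)" by blast
  then show ?thesis
    using assms(3) by (intro exI[of _ "nat (a * (z - x))"]) (auto simp: funpow_plus)
qed

lemma strict_mono_intI:
  fixes k :: "int \<Rightarrow> 'a :: order"
  assumes "\<And>i. k i < k (i + 1)"
  shows "strict_mono k"
proof
  fix i j :: int assume "i < j"
  then show "k i < k j"
    by (induction rule: int_gr_induct) (use assms order.strict_trans in blast)+
qed

text \<open>The neighbour of \<open>x\<close> in \<open>A\<close> on the side \<open>a = \<plusminus>1\<close> is the first return to \<open>A\<close> under translation
  by \<open>a\<close>.\<close>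

lemma first_return_range_strict_mono:
  fixes k :: "int \<Rightarrow> int"
  assumes "strict_mono k" "a \<in> {-1, 1}"
  shows "first_return ((+) a) (range k) (k i) = k (i + a)"
proof -
  have less: "k p < k q \<longleftrightarrow> p < q" for p q using assms(1) by (rule strict_mono_less)
  define n where "n = nat (a * (k (i + a) - k i))"
  have n: "0 < n" "k i + a * int n = k (i + a)"
    using assms(2) less[of i "i + 1"] less[of "i - 1" i] by (auto simp: n_def)
  have "k i + a * int j \<notin> range k" if "0 < j" "j < n" for j
  proof
    assume "k i + a * int j \<in> range k"
    then obtain m where m: "k m = k i + a * int j" by force
    show False
      using assms(2) m n(2) that less[of i m] less[of m i] less[of m "i + 1"] less[of "i - 1" m]
      by auto
  qed
  then show ?thesis
    using first_return_eqI[of n "(+) a" "k i" "range k"] n by (simp add: funpow_plus)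
qed

lemma strict_mono_int_unique:
  fixes k l :: "int \<Rightarrow> int"
  assumes "strict_mono k" "strict_mono l" "range k = range l" "k 0 = l 0"
  shows "k = l"
proof
  have step: "k (i + a) = l (i + a)" if "k i = l i" "a \<in> {-1, 1}" for i a
    using first_return_range_strict_mono assms that by metis
  show "k i = l i" for i
  proof (induction i rule: int_induct[where k = 0])
    case (step1 i)
    then show ?case using step[of i 1] by simp
  next
    case (step2 i)
    then show ?case using step[of i "-1"] by simp
  qed (rule assms(4))
qed

lemma first_return_plus_unbounded:
  fixes A :: "int set"
  assumes "\<not> bdd_above A" "\<not> bdd_below A" "a \<in> {-1, 1}"
  shows "first_return ((+) a) A x \<in> A" "0 < a * (first_return ((+) a) A x - x)"
proof -
  obtain n where "0 < n" "((+) a ^^ n) x \<in> A" using unbounded_int_set_meets_ray[OF assms] by blast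
  then obtain m where "0 < m" "first_return ((+) a) A x = ((+) a ^^ m) x"
    "first_return ((+) a) A x \<in> A"
    by (metis first_returnE)
  then show "first_return ((+) a) A x \<in> A" "0 < a * (first_return ((+) a) A x - x)"
    using assms(3) by (auto simp: funpow_plus)
qed

definition enumerate_int :: "int set \<Rightarrow> int \<Rightarrow> int" where
  "enumerate_int A i = (first_return ((+) (sgn i)) A ^^ nat \<bar>i\<bar>) 0"

lemma enumerate_int_0 [simp]: "enumerate_int A 0 = 0"
  by (simp add: enumerate_int_def)

lemma strict_mono_enumerate_int:
  assumes "\<not> bdd_above A" "\<not> bdd_below A"
  shows "strict_mono (enumerate_int A)"
proof (rule strict_mono_intI)
  fix i :: int
  show "enumerate_int A i < enumerate_int A (i + 1)"
  proof (cases "0 \<le> i")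
    case True
    then have "enumerate_int A (i + 1) = first_return ((+) 1) A (enumerate_int A i)"
      by (cases "i = 0") (auto simp: enumerate_int_def nat_add_distrib)
    then show ?thesis
      using first_return_plus_unbounded(2)[OF assms, of 1 "enumerate_int A i"] by simp
  next
    case False
    then have "nat \<bar>i\<bar> = Suc (nat \<bar>i + 1\<bar>)" by simp
    then have "enumerate_int A i = first_return ((+) (-1)) A (enumerate_int A (i + 1))"
      using False by (cases "i = -1") (auto simp: enumerate_int_def)
    then show ?thesis
      using first_return_plus_unbounded(2)[OF assms, of "-1" "enumerate_int A (i + 1)"] by simp
  qed
qed

lemma range_enumerate_int:
  assumes "\<not> bdd_above A" "\<not> bdd_below A" "0 \<in> A"
  shows "range (enumerate_int A) = A"
proof
  have "enumerate_int A i \<in> A" for i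
  proof (cases "nat \<bar>i\<bar>")
    case (Suc n)
    then have "sgn i \<in> {-1, 1}" by (auto simp: sgn_if)
    then show ?thesis
      using Suc first_return_plus_unbounded(1)[OF assms(1,2)] by (simp add: enumerate_int_def)
  qed (simp add: enumerate_int_def assms(3))
  then show "range (enumerate_int A) \<subseteq> A" by (rule image_subsetI)
next
  show "A \<subseteq> range (enumerate_int A)"
  proof
    fix z assume "z \<in> A"
    have z: "((+) (sgn z) ^^ nat \<bar>z\<bar>) 0 = z" by (simp add: funpow_plus sgn_if)
    define c where "c = card {j \<in> {0<..nat \<bar>z\<bar>}. ((+) (sgn z) ^^ j) 0 \<in> A}"
    have "(first_return ((+) (sgn z)) A ^^ c) 0 = z"
      using first_return_funpow_card_visits[of "nat \<bar>z\<bar>" "(+) (sgn z)" 0 A] z \<open>z \<in> A\<close>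
      by (simp add: c_def)
    then have "enumerate_int A (sgn z * int c) = z"
      by (cases "c = 0") (auto simp: enumerate_int_def sgn_mult abs_mult)
    then show "z \<in> range (enumerate_int A)" by (metis rangeI)
  qed
qed

subsection \<open>Kept positions\<close>

lemma Omega_sign: "u \<in> Omega \<Longrightarrow> u x \<in> {-1, 1}"
  by (auto simp: Omega_iff)

lemma shift_in_Omega: "u \<in> Omega \<Longrightarrow> (\<lambda>n. u (n + k)) \<in> Omega"
  by (auto simp: Omega_iff)

lemma in_K_iff: "u \<in> Omega \<Longrightarrow> x \<in> K u \<longleftrightarrow> u (x - u x) = u x"
  using Omega_sign[of u x] Omega_sign[of u "x + 1"] Omega_sign[of u "x - 1"]
  by (auto simp: K_def shift_pow_eq S_def shift_in_Omega add.commute)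

lemma removed_partner:
  assumes "u \<in> Omega" "x \<notin> K u"
  shows "u (x - u x) = - u x" "x - u x \<notin> K u"
  using assms Omega_sign[OF assms(1), of x] Omega_sign[OF assms(1), of "x - u x"]
  by (auto simp: in_K_iff)

lemma removed_adjacent_opposite:
  assumes "u \<in> Omega" "x \<notin> K u" "x + a \<notin> K u" "a \<in> {-1, 1}"
  shows "u (x + a) = - u x"
  using assms Omega_sign[OF assms(1), of x] Omega_sign[OF assms(1), of "x + a"]
  by (auto simp: in_K_iff)

text \<open>Travelling in the direction \<open>a\<close>, a removed pair is entered at the position with sign \<open>- a\<close>.\<close>

definition entry :: "seq \<Rightarrow> int \<Rightarrow> int \<Rightarrow> bool" where
  "entry u a x \<longleftrightarrow> x \<in> K u \<or> u x = - a"

lemma entry_after_kept: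
  assumes "u \<in> Omega" "x \<in> K u" "a \<in> {-1, 1}"
  shows "entry u a (x + a)"
proof (rule ccontr)
  assume "\<not> entry u a (x + a)"
  then have "x + a \<notin> K u" "u (x + a) = a"
    using assms(3) Omega_sign[OF assms(1), of "x + a"] by (auto simp: entry_def)
  then show False using removed_partner(2)[OF assms(1), of "x + a"] assms(2) by simp
qed

lemma entry_after_removed:
  assumes "u \<in> Omega" "x \<notin> K u"
  shows "entry u (u x) (x + u x)"
  using removed_adjacent_opposite[OF assms, of "u x"] Omega_sign[OF assms(1), of x]
  by (auto simp: entry_def)

subsection \<open>The walk\<close>

type_synonym state = "int \<times> int \<times> int \<times> int"

definition states :: "state set" where
  "states = UNIV \<times> UNIV \<times> N"

definition kept :: "seq \<Rightarrow> seq \<Rightarrow> state set" where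
  "kept u u' = K u \<times> K u' \<times> N"

definition walk :: "seq \<Rightarrow> seq \<Rightarrow> state \<Rightarrow> state" where
  "walk u u' = (\<lambda>(x, y, a, b). let s = u x * u' y in (x + s * b, y + s * a, s * b, s * a))"

definition reverse :: "seq \<Rightarrow> seq \<Rightarrow> state \<Rightarrow> state" where
  "reverse u u' = (\<lambda>(x, y, a, b). let s = u x * u' y in (x, y, - s * b, - s * a))"

definition swap_axes :: "state \<Rightarrow> state" where
  "swap_axes = (\<lambda>(x, y, a, b). (y, x, b, a))"

text \<open>Arrival at \<open>(x, y)\<close> along a row or a column; the sign \<open>e\<close> is constant along the walk.\<close>

definition horizontal :: "seq \<Rightarrow> int \<Rightarrow> int \<Rightarrow> int \<Rightarrow> state" where
  "horizontal u' e x y = (x, y, e * u' y, 0)"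

definition vertical :: "seq \<Rightarrow> int \<Rightarrow> int \<Rightarrow> int \<Rightarrow> state" where
  "vertical u e x y = (x, y, 0, e * u x)"

lemma in_N_iff: "(a, b) \<in> N \<longleftrightarrow> a \<in> {-1, 1} \<and> b = 0 \<or> a = 0 \<and> b \<in> {-1, 1}"
  by (auto simp: N_def)

lemma funpow_4: "(f ^^ 4) x = f (f (f (f x)))"
  by (simp add: eval_nat_numeral)

lemma swap_axes_swap_axes [simp]: "swap_axes (swap_axes p) = p"
  by (auto simp: swap_axes_def split: prod.splits)

lemma swap_axes_inject [simp]: "swap_axes p = swap_axes q \<longleftrightarrow> p = q"
  by (metis swap_axes_swap_axes)

lemma swap_axes_horizontal [simp]: "swap_axes (horizontal u' e x y) = vertical u' e y x"
  by (simp add: swap_axes_def horizontal_def vertical_def)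

lemma swap_axes_vertical [simp]: "swap_axes (vertical u e x y) = horizontal u e y x"
  by (simp add: swap_axes_def horizontal_def vertical_def)

lemma swap_axes_kept [simp]: "swap_axes p \<in> kept u' u \<longleftrightarrow> p \<in> kept u u'"
  by (auto simp: swap_axes_def kept_def in_N_iff split: prod.splits)

lemma walk_swap_axes [simp]: "walk u' u (swap_axes p) = swap_axes (walk u u' p)"
  by (auto simp: walk_def swap_axes_def Let_def mult.commute split: prod.splits)

lemma walk_swap_axes_funpow [simp]:
  "(walk u' u ^^ n) (swap_axes p) = swap_axes ((walk u u' ^^ n) p)"
  by (induction n) auto

lemma first_return_swap_axes:
  "first_return (walk u' u) (kept u' u) (swap_axes p) =
    swap_axes (first_return (walk u u') (kept u u') p)"
  by (simp add: first_return_def)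

locale sign_pair =
  fixes u u' :: seq
  assumes in_Omega: "u \<in> Omega" "u' \<in> Omega"
begin

lemma sign_pair_swap: "sign_pair u' u"
  by unfold_locales (rule in_Omega)+

lemmas sign = Omega_sign[OF in_Omega(1)] Omega_sign[OF in_Omega(2)]

lemma sign_square [simp]: "u x * u x = 1" "u' y * u' y = 1"
  using sign(1)[of x] sign(2)[of y] by auto

lemma sign_square_left [simp]: "u x * (u x * z) = z" "u' y * (u' y * z) = z"
  by (simp_all flip: mult.assoc)

lemma walk_horizontal [simp]:
  "walk u u' (horizontal u' e x y) = vertical u e x (y + e * u x)"
  by (simp add: walk_def horizontal_def vertical_def algebra_simps)

lemma walk_vertical [simp]:
  "walk u u' (vertical u e x y) = horizontal u' e (x + e * u' y) y"
  by (simp add: walk_def horizontal_def vertical_def algebra_simps)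

lemma horizontal_inject [simp]:
  "horizontal u' e x y = horizontal u' e' x' y' \<longleftrightarrow> e = e' \<and> x = x' \<and> y = y'"
  using sign(2)[of y] by (auto simp: horizontal_def)

lemma statesE:
  assumes "p \<in> states"
  obtains (horizontal) e x y where "e \<in> {-1, 1}" "p = horizontal u' e x y"
    | (vertical) e x y where "e \<in> {-1, 1}" "p = vertical u e x y"
proof -
  obtain x y a b where p: "p = (x, y, a, b)" by (metis prod.exhaust)
  show thesis
    using assms that(1)[of "a * u' y" x y] that(2)[of "b * u x" x y] sign(1)[of x] sign(2)[of y]
    by (auto simp: p states_def in_N_iff horizontal_def vertical_def)
qed

lemma horizontal_in_states: "e \<in> {-1, 1} \<Longrightarrow> horizontal u' e x y \<in> states"
  using sign(2)[of y] by (auto simp: states_def horizontal_def in_N_iff)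

lemma vertical_in_states: "e \<in> {-1, 1} \<Longrightarrow> vertical u e x y \<in> states"
  using sign(1)[of x] by (auto simp: states_def vertical_def in_N_iff)

lemma walk_in_states: "p \<in> states \<Longrightarrow> walk u u' p \<in> states"
  by (erule statesE) (simp_all only: walk_horizontal walk_vertical
      horizontal_in_states vertical_in_states)

lemma walk_funpow_in_states: "p \<in> states \<Longrightarrow> (walk u u' ^^ n) p \<in> states"
  by (induction n) (auto intro: walk_in_states)

lemma horizontal_in_kept: "e \<in> {-1, 1} \<Longrightarrow> horizontal u' e x y \<in> kept u u' \<longleftrightarrow> x \<in> K u \<and> y \<in> K u'"
  using sign(2)[of y] by (auto simp: kept_def horizontal_def in_N_iff)

lemma vertical_in_kept: "e \<in> {-1, 1} \<Longrightarrow> vertical u e x y \<in> kept u u' \<longleftrightarrow> x \<in> K u \<and> y \<in> K u'"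
  using sign(1)[of x] by (auto simp: kept_def vertical_def in_N_iff)

lemma reverse_horizontal: "reverse u u' (horizontal u' e x y) = vertical u (- e) x y"
  by (simp add: reverse_def horizontal_def vertical_def algebra_simps)

lemma reverse_vertical: "reverse u u' (vertical u e x y) = horizontal u' (- e) x y"
  by (simp add: reverse_def horizontal_def vertical_def algebra_simps)

lemma reverse_reverse: "reverse u u' (reverse u u' p) = p"
  by (auto simp: reverse_def Let_def algebra_simps split: prod.splits)

lemma reverse_in_kept: "p \<in> kept u u' \<Longrightarrow> reverse u u' p \<in> kept u u'"
  using sign(1)[of "fst p"] sign(2)[of "fst (snd p)"]
  by (auto simp: reverse_def kept_def in_N_iff)

lemma reverse_in_states: "p \<in> states \<Longrightarrow> reverse u u' p \<in> states"
  by (erule statesE) (auto simp: reverse_horizontal reverse_vertical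
      intro!: horizontal_in_states vertical_in_states)

lemma walk_reverse_walk: "walk u u' (reverse u u' (walk u u' p)) = reverse u u' p"
proof -
  obtain x y a b where p: "p = (x, y, a, b)" by (metis prod.exhaust)
  define s where "s = u x * u' y"
  define t where "t = u (x + s * b) * u' (y + s * a)"
  have "t * t = 1" by (simp add: t_def algebra_simps)
  then have "t * (t * z) = z" for z by (simp flip: mult.assoc)
  then show ?thesis
    by (simp add: p walk_def reverse_def flip: s_def t_def)
qed

lemma walk_funpow_reverse_walk_funpow:
  "(walk u u' ^^ n) (reverse u u' ((walk u u' ^^ n) p)) = reverse u u' p"
proof (induction n arbitrary: p)
  case (Suc n)
  have "(walk u u' ^^ Suc n) (reverse u u' ((walk u u' ^^ Suc n) p)) =
      (walk u u' ^^ n) (walk u u' (reverse u u' (walk u u' ((walk u u' ^^ n) p))))"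
    by (simp add: funpow_swap1)
  then show ?case using Suc.IH by (simp only: walk_reverse_walk)
qed simp

lemma walk_inject: "walk u u' p = walk u u' q \<longleftrightarrow> p = q"
  by (metis walk_reverse_walk reverse_reverse)

lemma four_step_loop_iff:
  assumes "e \<in> {-1, 1}"
  shows "(walk u u' ^^ 4) (horizontal u' e x y) = horizontal u' e x y \<longleftrightarrow>
    u' (y + e * u x) = - u' y \<and> u (x - e * u' y) = - u x"
proof -
  define y1 where "y1 = y + e * u x"
  define x1 where "x1 = x + e * u' y1"
  define y2 where "y2 = y1 + e * u x1"
  have "(walk u u' ^^ 4) (horizontal u' e x y) = horizontal u' e (x1 + e * u' y2) y2"
    by (simp add: funpow_4 y1_def x1_def y2_def)
  then have "(walk u u' ^^ 4) (horizontal u' e x y) = horizontal u' e x y \<longleftrightarrow>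
      y2 = y \<and> u' y1 = - u' y"
    using assms by (auto simp: x1_def)
  moreover have "y2 = y \<longleftrightarrow> u x1 = - u x" using assms by (auto simp: y2_def y1_def)
  moreover have "x1 = x - e * u' y" if "u' y1 = - u' y" using that by (simp add: x1_def)
  ultimately show ?thesis unfolding y1_def[symmetric] by metis
qed

lemma kept_horizontal_not_four_step_loop:
  assumes "e \<in> {-1, 1}" "x \<in> K u" "y \<in> K u'"
  shows "(walk u u' ^^ 4) (horizontal u' e x y) \<noteq> horizontal u' e x y"
proof
  assume "(walk u u' ^^ 4) (horizontal u' e x y) = horizontal u' e x y"
  then have loop: "u' (y + e * u x) = - u' y" "u (x - e * u' y) = - u x"
    using four_step_loop_iff[OF assms(1)] by auto
  consider (horizontal) "u x = e * u' y" | (vertical) "u' y = - e * u x"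
    using assms(1) sign(1)[of x] sign(2)[of y] by auto
  then show False
  proof cases
    case horizontal
    then have "u (x - u x) = - u x" using loop(2) by simp
    then show False using assms(2) sign(1)[of x] by (auto simp: in_K_iff in_Omega)
  next
    case vertical
    then have "u' (y - u' y) = - u' y" using loop(1) by simp
    then show False using assms(3) sign(2)[of y] by (auto simp: in_K_iff in_Omega)
  qed
qed

lemma kept_not_four_step_loop:
  assumes "p \<in> kept u u'"
  shows "(walk u u' ^^ 4) p \<noteq> p"
proof -
  have "p \<in> states" using assms by (auto simp: kept_def states_def)
  then show ?thesis
  proof (cases rule: statesE)
    case (horizontal e x y)
    then show ?thesis
      using kept_horizontal_not_four_step_loop assms horizontal_in_kept by blast
  next
    case (vertical e x y)
    then have "x \<in> K u" "y \<in> K u'" using assms vertical_in_kept by auto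
    then show ?thesis
      using sign_pair.kept_horizontal_not_four_step_loop[OF sign_pair_swap, of e y x] vertical
      by (simp flip: swap_axes_vertical)
  qed
qed

lemma walk_not_closed_below_four:
  assumes "p \<in> states" "0 < m" "m < 4"
  shows "(walk u u' ^^ m) p \<noteq> p"
proof -
  obtain x y a b where p: "p = (x, y, a, b)" by (metis prod.exhaust)
  have nonzero: "u z \<noteq> 0" "u' z \<noteq> 0" for z using sign[of z] by auto
  consider "m = 1" | "m = 2" | "m = 3" using assms(2,3) by linarith
  then show ?thesis
    using nonzero assms(1)
    by cases (auto simp: p walk_def Let_def states_def in_N_iff eval_nat_numeral)
qed

subsection \<open>Traversing removed columns\<close>

lemma walk_across_removed_pair:
  assumes "e \<in> {-1, 1}" "y \<in> K u'" "x \<notin> K u" "u x = - a" and a: "a = e * u' y"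
  shows "(walk u u' ^^ 4) (horizontal u' e x y) = horizontal u' e (x + 2 * a) y"
    and "j < 4 \<Longrightarrow> (walk u u' ^^ j) (horizontal u' e x y) \<notin> kept u u'"
proof -
  have partner: "u (x + a) = a" "x + a \<notin> K u"
    using removed_partner[OF in_Omega(1) assms(3)] assms(4) by auto
  have same: "u' (y - u' y) = u' y" using assms(2) by (simp add: in_K_iff in_Omega)
  have e_a: "e * a = u' y" and e_u: "e * u x = - u' y" using assms(1,4) by (auto simp: a)
  have steps: "walk u u' (horizontal u' e x y) = vertical u e x (y - u' y)"
    "walk u u' (vertical u e x (y - u' y)) = horizontal u' e (x + a) (y - u' y)"
    "walk u u' (horizontal u' e (x + a) (y - u' y)) = vertical u e (x + a) y"
    "walk u u' (vertical u e (x + a) y) = horizontal u' e (x + 2 * a) y"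
    by (simp_all add: e_u same partner e_a flip: a)
  show "(walk u u' ^^ 4) (horizontal u' e x y) = horizontal u' e (x + 2 * a) y"
    by (simp only: funpow_4 steps)
  assume "j < 4"
  then consider "j = 0" | "j = 1" | "j = 2" | "j = 3" by linarith
  then show "(walk u u' ^^ j) (horizontal u' e x y) \<notin> kept u u'"
    using assms(3) partner(2) horizontal_in_kept[OF assms(1)] vertical_in_kept[OF assms(1)]
    by cases (simp_all add: eval_nat_numeral steps del: walk_horizontal walk_vertical)
qed

lemma walk_to_next_kept_column:
  assumes "e \<in> {-1, 1}" "y \<in> K u'" and a: "a = e * u' y"
    and "entry u a x" "x + a * int d \<in> K u" "\<And>i. i < d \<Longrightarrow> x + a * int i \<notin> K u"
  shows "\<exists>n. (walk u u' ^^ n) (horizontal u' e x y) = horizontal u' e (x + a * int d) y \<and>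
    (\<forall>j<n. (walk u u' ^^ j) (horizontal u' e x y) \<notin> kept u u')"
  using assms(4-)
proof (induction d arbitrary: x rule: less_induct)
  case (less d)
  show ?case
  proof (cases "d = 0")
    case True
    then show ?thesis by (intro exI[of _ 0]) simp
  next
    case False
    then have x: "x \<notin> K u" "u x = - a"
      using less.prems(1) less.prems(3)[of 0] by (auto simp: entry_def)
    then have partner: "x + a \<notin> K u" "u (x + a) = a"
      using removed_partner[OF in_Omega(1) x(1)] by auto
    then have "d \<noteq> 1" using less.prems(2) by auto
    then obtain c where d: "d = Suc (Suc c)" using False by (metis One_nat_def not0_implies_Suc)
    have "entry u a (x + 2 * a)"
      using entry_after_removed[OF in_Omega(1) partner(1)] partner(2) by (simp add: algebra_simps)
    moreover have "x + 2 * a + a * int c \<in> K u"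
      using less.prems(2) by (simp add: d algebra_simps)
    moreover have "x + 2 * a + a * int i \<notin> K u" if "i < c" for i
      using less.prems(3)[of "Suc (Suc i)"] that by (simp add: d algebra_simps)
    ultimately obtain n where
      arrives: "(walk u u' ^^ n) (horizontal u' e (x + 2 * a) y) =
        horizontal u' e (x + 2 * a + a * int c) y"
      and avoids: "\<And>j. j < n \<Longrightarrow> (walk u u' ^^ j) (horizontal u' e (x + 2 * a) y) \<notin> kept u u'"
      using less.IH[of c "x + 2 * a"] d by auto
    note pass = walk_across_removed_pair[OF assms(1,2) x a]
    have "(walk u u' ^^ (n + 4)) (horizontal u' e x y) = horizontal u' e (x + a * int d) y"
      unfolding funpow_add_apply pass(1) arrives by (simp add: d algebra_simps)
    moreover have "(walk u u' ^^ j) (horizontal u' e x y) \<notin> kept u u'" if "j < n + 4" for j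
    proof (cases "j < 4")
      case False
      then have "(walk u u' ^^ j) (horizontal u' e x y) =
          (walk u u' ^^ (j - 4)) (horizontal u' e (x + 2 * a) y)"
        by (simp flip: pass(1) funpow_add_apply)
      then show ?thesis using avoids[of "j - 4"] that False by auto
    qed (rule pass(2))
    ultimately show ?thesis by blast
  qed
qed

end

subsection \<open>Returning to the kept states\<close>

locale unbounded_pair = sign_pair +
  assumes unbounded: "unbounded_collapsible u" "unbounded_collapsible u'"
begin

lemma unbounded_pair_swap: "unbounded_pair u' u"
  by unfold_locales (rule in_Omega unbounded)+

lemma K_meets_ray: "a \<in> {-1, 1} \<Longrightarrow> \<exists>n>0. ((+) a ^^ n) x \<in> K u"
  using unbounded_int_set_meets_ray unbounded(1) by (simp add: unbounded_collapsible_def)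

lemma first_return_vertical:
  assumes "e \<in> {-1, 1}" "x \<in> K u" "y \<in> K u'"
  shows "first_return (walk u u') (kept u u') (vertical u e x y) =
    horizontal u' e (first_return ((+) (e * u' y)) (K u) x) y"
proof -
  define a where "a = e * u' y"
  have sign_a: "a \<in> {-1, 1}" using assms(1) sign(2)[of y] by (auto simp: a_def)
  obtain d where column: "x + a * int (Suc d) \<in> K u"
    "first_return ((+) a) (K u) x = x + a * int (Suc d)"
    and removed: "\<And>i. 0 < i \<Longrightarrow> i < Suc d \<Longrightarrow> x + a * int i \<notin> K u"
    using K_meets_ray[OF sign_a, of x] first_returnE[of _ "(+) a" x "K u"]
    unfolding funpow_plus by (metis gr0_implies_Suc)
  have "x + a + a * int i \<notin> K u" if "i < d" for i
    using removed[of "Suc i"] that by (simp add: algebra_simps)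
  then obtain n where
    arrives: "(walk u u' ^^ n) (horizontal u' e (x + a) y) =
      horizontal u' e (x + a * int (Suc d)) y"
    and avoids: "\<And>j. j < n \<Longrightarrow> (walk u u' ^^ j) (horizontal u' e (x + a) y) \<notin> kept u u'"
    using walk_to_next_kept_column[OF assms(1,3) a_def
        entry_after_kept[OF in_Omega(1) assms(2) sign_a], of d] column(1)
    by (auto simp: algebra_simps)
  have step: "(walk u u' ^^ Suc j) (vertical u e x y) =
      (walk u u' ^^ j) (horizontal u' e (x + a) y)" for j by (simp add: funpow_swap1 a_def)
  have "first_return (walk u u') (kept u u') (vertical u e x y) =
      (walk u u' ^^ Suc n) (vertical u e x y)"
  proof (rule first_return_eqI)
    show "(walk u u' ^^ Suc n) (vertical u e x y) \<in> kept u u'"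
      unfolding step arrives using horizontal_in_kept[OF assms(1)] column(1) assms(3) by simp
    show "(walk u u' ^^ j) (vertical u e x y) \<notin> kept u u'" if "0 < j" "j < Suc n" for j
      using that avoids[of "j - 1"] step[of "j - 1"] by simp
  qed simp
  then show ?thesis by (simp only: step arrives column(2) flip: a_def)
qed

lemma first_return_horizontal:
  assumes "e \<in> {-1, 1}" "x \<in> K u" "y \<in> K u'"
  shows "first_return (walk u u') (kept u u') (horizontal u' e x y) =
    vertical u e x (first_return ((+) (e * u x)) (K u') y)"
proof -
  interpret swapped: unbounded_pair u' u by (rule unbounded_pair_swap)
  have "swap_axes (first_return (walk u u') (kept u u') (horizontal u' e x y)) =
      first_return (walk u' u) (kept u' u) (vertical u' e y x)"
    by (simp flip: first_return_swap_axes)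
  also have "\<dots> = swap_axes (vertical u e x (first_return ((+) (e * u x)) (K u') y))"
    using swapped.first_return_vertical assms by simp
  finally show ?thesis by (simp only: swap_axes_inject)
qed

end

definition loops_or_meets_kept :: "seq \<Rightarrow> seq \<Rightarrow> state \<Rightarrow> bool" where
  "loops_or_meets_kept u u' p \<longleftrightarrow>
    (walk u u' ^^ 4) p = p \<or> (\<exists>n. (walk u u' ^^ n) p \<in> kept u u')"

lemma loops_or_meets_kept_swap_axes [simp]:
  "loops_or_meets_kept u' u (swap_axes p) \<longleftrightarrow> loops_or_meets_kept u u' p"
  by (simp add: loops_or_meets_kept_def)

context unbounded_pair
begin

lemma loops_or_meets_kept_walk_iff:
  "loops_or_meets_kept u u' (walk u u' p) \<longleftrightarrow>
    (walk u u' ^^ 4) p = p \<or> (\<exists>n>0. (walk u u' ^^ n) p \<in> kept u u')"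
proof -
  have step: "(walk u u' ^^ n) (walk u u' p) = walk u u' ((walk u u' ^^ n) p)" for n
    by (simp add: funpow_swap1)
  show ?thesis
    unfolding loops_or_meets_kept_def step walk_inject by (auto simp: gr0_conv_Suc)
qed

lemma loops_or_meets_kept_walkD:
  "loops_or_meets_kept u u' (walk u u' p) \<Longrightarrow> loops_or_meets_kept u u' p"
  unfolding loops_or_meets_kept_walk_iff by (auto simp: loops_or_meets_kept_def)

lemma horizontal_entry_meets_kept:
  assumes "e \<in> {-1, 1}" "y \<in> K u'" "entry u (e * u' y) x"
  shows "\<exists>n. (walk u u' ^^ n) (horizontal u' e x y) \<in> kept u u'"
proof -
  have "e * u' y \<in> {-1, 1}" using assms(1) sign(2)[of y] by auto
  then obtain d where "x + e * u' y * int d \<in> K u" "\<And>i. i < d \<Longrightarrow> x + e * u' y * int i \<notin> K u"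
    using K_meets_ray[of "e * u' y" x] exists_least_iff[of "\<lambda>d. x + e * u' y * int d \<in> K u"]
    by (auto simp: funpow_plus)
  then show ?thesis
    using walk_to_next_kept_column[OF assms(1,2) refl assms(3)] horizontal_in_kept[OF assms(1)]
      assms(2) by metis
qed

lemma kept_row_loops_or_meets_kept:
  assumes "e \<in> {-1, 1}" "y \<in> K u'"
  shows "loops_or_meets_kept u u' (horizontal u' e x y)"
proof -
  have meets: "loops_or_meets_kept u u' (horizontal u' e z w)"
    if "w \<in> K u'" "entry u (e * u' w) z" for z w
    using horizontal_entry_meets_kept[OF assms(1) that] by (simp add: loops_or_meets_kept_def)
  show ?thesis
  proof (cases "entry u (e * u' y) x")
    case True
    then show ?thesis using meets assms(2) by simp
  next
    case False
    then have x: "x \<notin> K u" and ux: "u x = e * u' y"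
      using assms(1) sign(1)[of x] sign(2)[of y] by (auto simp: entry_def)
    have step_y: "y + e * u x = y + u' y" using assms(1) by (auto simp: ux)
    consider (same) "u' (y + u' y) = u' y" | (opposite) "u' (y + u' y) = - u' y"
      using sign(2)[of y] sign(2)[of "y + u' y"] by auto
    then show ?thesis
    proof cases
      case same
      have "walk u u' (walk u u' (horizontal u' e x y)) = horizontal u' e (x + u x) (y + u' y)"
        by (simp add: step_y same flip: ux)
      moreover have "y + u' y \<in> K u'" using same by (simp add: in_K_iff in_Omega)
      moreover have "entry u (e * u' (y + u' y)) (x + u x)"
        using entry_after_removed[OF in_Omega(1) x] by (simp add: same flip: ux)
      ultimately show ?thesis using meets loops_or_meets_kept_walkD by metis
    next
      case opposite
      have "u (x - u x) = - u x" using removed_partner(1)[OF in_Omega(1) x] .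
      then have "(walk u u' ^^ 4) (horizontal u' e x y) = horizontal u' e x y"
        using four_step_loop_iff[OF assms(1)] opposite by (simp add: step_y flip: ux)
      then show ?thesis by (simp add: loops_or_meets_kept_def)
    qed
  qed
qed

lemma kept_column_loops_or_meets_kept:
  assumes "e \<in> {-1, 1}" "x \<in> K u"
  shows "loops_or_meets_kept u u' (vertical u e x y)"
proof -
  interpret swapped: unbounded_pair u' u by (rule unbounded_pair_swap)
  show ?thesis
    using swapped.kept_row_loops_or_meets_kept[OF assms, of y]
    by (simp flip: swap_axes_vertical)
qed

lemma horizontal_loops_or_meets_kept:
  assumes "e \<in> {-1, 1}"
  shows "loops_or_meets_kept u u' (horizontal u' e x y)"
proof -
  note kept_row = kept_row_loops_or_meets_kept[OF assms]
  note kept_column = kept_column_loops_or_meets_kept[OF assms]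
  note predecessor = loops_or_meets_kept_walkD
  define y1 where "y1 = y + e * u x"
  define x1 where "x1 = x + e * u' y1"
  have first_step: "walk u u' (horizontal u' e x y) = vertical u e x y1" by (simp add: y1_def)
  have second_step: "walk u u' (vertical u e x y1) = horizontal u' e x1 y1" by (simp add: x1_def)
  have third_step: "walk u u' (horizontal u' e x1 y1) = vertical u e x1 (y1 + e * u x1)" by simp
  consider (row) "y \<in> K u'" | (column) "x \<in> K u"
    | (next_row) "y1 \<in> K u'" | (next_column) "x1 \<in> K u"
    | (removed) "y \<notin> K u'" "x \<notin> K u" "y1 \<notin> K u'" "x1 \<notin> K u" by blast
  then show ?thesis
  proof cases
    case row
    then show ?thesis by (rule kept_row)
  next
    case column
    then show ?thesis using kept_column predecessor first_step by metis
  next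
    case next_row
    then show ?thesis using kept_row predecessor first_step second_step by metis
  next
    case next_column
    then show ?thesis using kept_column predecessor first_step second_step third_step by metis
  next
    case removed
    have "u' y1 = - u' y"
      unfolding y1_def using removed assms sign(1)[of x]
      by (intro removed_adjacent_opposite in_Omega) (auto simp: y1_def)
    moreover have "u x1 = - u x"
      unfolding x1_def using removed assms sign(2)[of y1]
      by (intro removed_adjacent_opposite in_Omega) (auto simp: x1_def)
    ultimately have "(walk u u' ^^ 4) (horizontal u' e x y) = horizontal u' e x y"
      unfolding four_step_loop_iff[OF assms] by (simp add: x1_def y1_def)
    then show ?thesis by (simp add: loops_or_meets_kept_def)
  qed
qed

lemma states_loops_or_meets_kept:
  assumes "p \<in> states"
  shows "loops_or_meets_kept u u' p"
  using assms
proof (cases rule: statesE)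
  case (vertical e x y)
  then have "loops_or_meets_kept u u' (walk u u' p)"
    using horizontal_loops_or_meets_kept by simp
  then show ?thesis by (rule loops_or_meets_kept_walkD)
qed (simp only: horizontal_loops_or_meets_kept)

lemma walk_returns_to_kept:
  assumes "p \<in> states" "(walk u u' ^^ 4) p \<noteq> p"
  shows "\<exists>n>0. (walk u u' ^^ n) p \<in> kept u u'"
proof -
  have "loops_or_meets_kept u u' (walk u u' p)"
    by (intro states_loops_or_meets_kept walk_in_states assms(1))
  then show ?thesis using assms(2) by (simp add: loops_or_meets_kept_walk_iff)
qed

lemma walk_comes_from_kept:
  assumes "p \<in> states" "(walk u u' ^^ 4) p \<noteq> p"
  shows "\<exists>n>0. \<exists>q\<in>kept u u'. (walk u u' ^^ n) q = p"
proof -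
  let ?p = "reverse u u' p"
  have round_trip: "(walk u u' ^^ n) (reverse u u' ((walk u u' ^^ n) ?p)) = p" for n
    using walk_funpow_reverse_walk_funpow[of n ?p] by (simp add: reverse_reverse)
  then have "(walk u u' ^^ 4) ?p \<noteq> ?p" using assms(2) reverse_reverse by metis
  then obtain n where "0 < n" "(walk u u' ^^ n) ?p \<in> kept u u'"
    using walk_returns_to_kept reverse_in_states assms(1) by metis
  then show ?thesis using round_trip reverse_in_kept by blast
qed

end

subsection \<open>Closed walks\<close>

context sign_pair
begin

lemma kept_horizontal_drift:
  assumes "e \<in> {-1, 1}" "u x = - e * u' y"
    and kept: "\<And>j. (walk u u' ^^ j) (horizontal u' e x y) \<in> kept u u'"
  shows "(walk u u' ^^ (2 * j)) (horizontal u' e x y) =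
      horizontal u' e (x - int j * u x) (y - int j * u' y)
    \<and> u (x - int j * u x) = u x \<and> u' (y - int j * u' y) = u' y"
proof (induction j)
  case (Suc j)
  define z w where "z = x - int j * u x" and "w = y - int j * u' y"
  have IH: "(walk u u' ^^ (2 * j)) (horizontal u' e x y) = horizontal u' e z w"
    "u z = u x" "u' w = u' y" using Suc.IH by (auto simp: z_def w_def)
  have "z \<in> K u" "w \<in> K u'" using kept[of "2 * j"] IH(1) horizontal_in_kept[OF assms(1)] by auto
  then have same: "u (z - u x) = u x" "u' (w - u' y) = u' y"
    using IH by (auto simp: in_K_iff in_Omega)
  have e_u: "e * u x = - u' y" "e * u' y = - u x" using assms(1,2) by auto
  have "(walk u u' ^^ (2 * Suc j)) (horizontal u' e x y) =
      walk u u' (walk u u' (horizontal u' e z w))" by (simp add: IH(1))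
  also have "\<dots> = horizontal u' e (z - u x) (w - u' y)" by (simp add: IH(2) e_u same)
  finally show ?case using same by (simp add: z_def w_def algebra_simps)
qed simp

lemma kept_horizontal_drift_not_closed:
  assumes "e \<in> {-1, 1}" "u x = - e * u' y" "0 < n"
    and "\<And>j. (walk u u' ^^ j) (horizontal u' e x y) \<in> kept u u'"
  shows "(walk u u' ^^ n) (horizontal u' e x y) \<noteq> horizontal u' e x y"
proof
  assume "(walk u u' ^^ n) (horizontal u' e x y) = horizontal u' e x y"
  then have "(walk u u' ^^ (2 * n)) (horizontal u' e x y) = horizontal u' e x y"
    by (simp add: mult_2 funpow_add_apply)
  then show False using kept_horizontal_drift[OF assms(1,2,4), of n] \<open>0 < n\<close> sign(1)[of x] by auto
qed

lemma kept_drift_not_closed: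
  assumes "e \<in> {-1, 1}" "u x = - e * u' y" "0 < n"
    and p: "p \<in> {horizontal u' e x y, vertical u e x y}"
    and kept: "\<And>j. (walk u u' ^^ j) p \<in> kept u u'"
  shows "(walk u u' ^^ n) p \<noteq> p"
proof (cases "p = horizontal u' e x y")
  case True
  then show ?thesis using kept_horizontal_drift_not_closed assms(1-3) kept by simp
next
  case False
  then have swap_axes_p: "swap_axes p = horizontal u e y x" using p by simp
  interpret swapped: sign_pair u' u by (rule sign_pair_swap)
  have "u' y = - e * u x" using assms(1,2) by auto
  moreover have "(walk u' u ^^ j) (horizontal u e y x) \<in> kept u' u" for j
    using kept by (simp flip: swap_axes_p)
  ultimately have "(walk u' u ^^ n) (horizontal u e y x) \<noteq> horizontal u e y x"
    using swapped.kept_horizontal_drift_not_closed assms(1,3) by blast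
  then show ?thesis by (simp flip: swap_axes_p)
qed

lemma reverse_closed_orbit:
  assumes "0 < n" "(walk u u' ^^ n) p = p"
  shows "(walk u u' ^^ n) (reverse u u' p) = reverse u u' p"
    and "\<exists>i. (walk u u' ^^ j) (reverse u u' p) = reverse u u' ((walk u u' ^^ i) p)"
proof -
  show "(walk u u' ^^ n) (reverse u u' p) = reverse u u' p"
    using walk_funpow_reverse_walk_funpow[of n p] assms(2) by simp
  have "(walk u u' ^^ (n * j)) p = p"
    using funpow_mod_eq[OF assms(2), of "n * j"] by simp
  then have "(walk u u' ^^ j) ((walk u u' ^^ (n * j - j)) p) = p"
    using assms(1) by (simp flip: funpow_add_apply)
  then show "\<exists>i. (walk u u' ^^ j) (reverse u u' p) = reverse u u' ((walk u u' ^^ i) p)"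
    using walk_funpow_reverse_walk_funpow[of j] by metis
qed

lemma kept_orbit_not_closed:
  assumes "0 < n" and kept: "\<And>j. (walk u u' ^^ j) p \<in> kept u u'"
  shows "(walk u u' ^^ n) p \<noteq> p"
proof
  assume closed: "(walk u u' ^^ n) p = p"
  note reversed = reverse_closed_orbit[OF \<open>0 < n\<close> closed]
  have reversed_kept: "(walk u u' ^^ j) (reverse u u' p) \<in> kept u u'" for j
    using reversed(2)[of j] reverse_in_kept kept by metis
  have "p \<in> states" using kept[of 0] by (auto simp: kept_def states_def)
  then obtain e x y where e: "e \<in> {-1, 1}" and p: "p \<in> {horizontal u' e x y, vertical u e x y}"
    by (blast elim: statesE)
  then have reverse_p: "reverse u u' p \<in> {horizontal u' (- e) x y, vertical u (- e) x y}"
    by (auto simp: reverse_horizontal reverse_vertical)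
  consider (forwards) "u x = - e * u' y" | (backwards) "u x = - (- e) * u' y"
    using e sign(1)[of x] sign(2)[of y] by auto
  then show False
  proof cases
    case forwards
    then show False using kept_drift_not_closed[OF e _ \<open>0 < n\<close> p] kept closed by blast
  next
    case backwards
    moreover have "- e \<in> {-1, 1}" using e by auto
    ultimately show False
      using kept_drift_not_closed[OF _ _ \<open>0 < n\<close> reverse_p] reversed(1) reversed_kept by blast
  qed
qed

end

subsection \<open>Stable periodicity as closedness of the walk\<close>

definition recenter :: "seq \<Rightarrow> seq \<Rightarrow> state \<Rightarrow> point" where
  "recenter u u' = (\<lambda>(x, y, v). (\<lambda>n. u (n + x), \<lambda>n. u' (n + y), v))"

lemma recenter_origin: "recenter u u' (0, 0, v) = (u, u', v)"
  by (simp add: recenter_def)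

lemma (in sign_pair) Phi_recenter: "Phi (recenter u u' p) = recenter u u' (walk u u' p)"
proof -
  obtain x y a b where p: "p = (x, y, a, b)" by (metis prod.exhaust)
  show ?thesis
    using in_Omega
    by (simp add: p recenter_def walk_def Let_def shift_pow_eq shift_in_Omega algebra_simps)
qed

lemma (in sign_pair) Phi_funpow_recenter:
  "(Phi ^^ n) (recenter u u' p) = recenter u u' ((walk u u' ^^ n) p)"
  by (induction n) (auto simp: Phi_recenter simp del: Phi.simps)

definition cylinder :: "seq \<Rightarrow> int set \<Rightarrow> seq set" where
  "cylinder w F = {\<eta> \<in> Omega. \<forall>x\<in>F. \<eta> x = w x}"

lemma openin_cylinder:
  assumes "w \<in> Omega" "finite F"
  shows "openin Omega_top (cylinder w F)"
proof -
  have "cylinder w F = (\<Pi>\<^sub>E x\<in>UNIV. if x \<in> F then {w x} else {-1, 1})"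
  proof (rule set_eqI)
    fix \<eta>
    show "\<eta> \<in> cylinder w F \<longleftrightarrow> \<eta> \<in> (\<Pi>\<^sub>E x\<in>UNIV. if x \<in> F then {w x} else {-1, 1})"
      using assms(1)
      by (simp add: cylinder_def Omega_iff PiE_iff) (metis insertCI insertE singletonD)
  qed
  moreover have "finite {x. (if x \<in> F then {w x} else {-1, 1 :: int}) \<noteq> {-1, 1}}"
    by (rule finite_subset[OF _ assms(2)]) auto
  ultimately show ?thesis
    using assms(1) unfolding Omega_top_def
    by (auto intro!: product_topology_basis simp: Omega_iff)
qed

lemma openin_contains_cylinder:
  assumes "openin Omega_top U" "w \<in> U"
  obtains F where "finite F" "cylinder w F \<subseteq> U"
proof -
  obtain V where V: "finite {i. V i \<noteq> {-1, 1 :: int}}" "w \<in> PiE UNIV V" "PiE UNIV V \<subseteq> U"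
    using assms unfolding Omega_top_def openin_product_topology_alt by fastforce
  have "cylinder w {i. V i \<noteq> {-1, 1}} \<subseteq> PiE UNIV V"
  proof
    fix \<eta> assume \<eta>: "\<eta> \<in> cylinder w {i. V i \<noteq> {-1, 1}}"
    have "\<eta> x \<in> V x" for x
      using \<eta> Omega_sign[of \<eta> x] V(2) by (cases "V x = {-1, 1}") (auto simp: cylinder_def PiE_iff)
    then show "\<eta> \<in> PiE UNIV V" by (simp add: PiE_iff)
  qed
  then show thesis using that V(1,3) by blast
qed

text \<open>If every sequence near \<open>w\<close> had period \<open>x \<noteq> 0\<close>, changing one remote entry would break this.\<close>

lemma locally_periodic_imp_zero:
  assumes "openin Omega_top U" "w \<in> U" and period: "\<And>\<eta>. \<eta> \<in> U \<Longrightarrow> (\<lambda>z. \<eta> (z + x)) = \<eta>"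
  shows "x = 0"
proof (rule ccontr)
  assume "x \<noteq> 0"
  have w: "w \<in> Omega" using openin_subset[OF assms(1)] assms(2) by (auto simp: Omega_def)
  obtain F where F: "finite F" "cylinder w F \<subseteq> U"
    using openin_contains_cylinder[OF assms(1,2)] .
  obtain M where "M \<notin> F" using ex_new_if_finite infinite_UNIV_int F(1) by blast
  define \<eta> where "\<eta> = w(M := - w M)"
  have "\<eta> \<in> cylinder w F" using w \<open>M \<notin> F\<close> by (auto simp: \<eta>_def cylinder_def Omega_iff)
  then have "\<eta> \<in> U" using F(2) by blast
  then have "\<eta> (M + x) = \<eta> M" using period by metis
  moreover have "w (M + x) = w M" using period \<open>w \<in> U\<close> by metis
  ultimately show False using \<open>x \<noteq> 0\<close> Omega_sign[OF w, of M] by (auto simp: \<eta>_def)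
qed

abbreviation near :: "nat \<Rightarrow> seq \<Rightarrow> seq set" where
  "near n w \<equiv> cylinder w {- int n..int n}"

context sign_pair
begin

lemma walk_funpow_position_bound:
  assumes "v \<in> N" "(walk u u' ^^ n) (0, 0, v) = (x, y, w)"
  shows "\<bar>x\<bar> \<le> int n" "\<bar>y\<bar> \<le> int n"
proof -
  have "\<bar>x\<bar> \<le> int n \<and> \<bar>y\<bar> \<le> int n"
    using assms(2)
  proof (induction n arbitrary: x y w)
    case (Suc n)
    obtain x0 y0 a b where pos: "(walk u u' ^^ n) (0, 0, v) = (x0, y0, a, b)"
      by (metis prod.exhaust)
    have "(a, b) \<in> N"
      using walk_funpow_in_states[of "(0, 0, v)" n] assms(1) by (simp add: pos states_def)
    then show ?case
      using Suc.IH[OF pos] Suc.prems pos sign(1)[of x0] sign(2)[of y0]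
      by (auto simp: walk_def Let_def in_N_iff)
  qed simp
  then show "\<bar>x\<bar> \<le> int n" "\<bar>y\<bar> \<le> int n" by auto
qed

lemma walk_funpow_cong:
  assumes "v \<in> N" "\<eta> \<in> near n u" "\<eta>' \<in> near n u'"
  shows "(walk \<eta> \<eta>' ^^ n) (0, 0, v) = (walk u u' ^^ n) (0, 0, v)"
proof -
  have "(walk \<eta> \<eta>' ^^ j) (0, 0, v) = (walk u u' ^^ j) (0, 0, v)" if "j \<le> n" for j
    using that
  proof (induction j)
    case (Suc j)
    obtain x y a b where pos: "(walk u u' ^^ j) (0, 0, v) = (x, y, a, b)" by (metis prod.exhaust)
    then have "x \<in> {- int n..int n}" "y \<in> {- int n..int n}"
      using walk_funpow_position_bound[OF assms(1) pos] Suc.prems by auto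
    then have "\<eta> x = u x" "\<eta>' y = u' y" using assms(2,3) by (auto simp: cylinder_def)
    then have "walk \<eta> \<eta>' (x, y, a, b) = walk u u' (x, y, a, b)" by (simp add: walk_def)
    then show ?case using Suc pos by simp
  qed simp
  then show ?thesis by blast
qed

lemma Phi_funpow_near:
  assumes "v \<in> N" "\<eta> \<in> near n u" "\<eta>' \<in> near n u'"
  shows "(Phi ^^ n) (\<eta>, \<eta>', v) = recenter \<eta> \<eta>' ((walk u u' ^^ n) (0, 0, v))"
proof -
  interpret \<eta>: sign_pair \<eta> \<eta>' using assms(2,3) by unfold_locales (auto simp: cylinder_def)
  show ?thesis
    using \<eta>.Phi_funpow_recenter[of n "(0, 0, v)"] walk_funpow_cong[OF assms]
    by (simp add: recenter_origin)
qed

lemma openin_near: "openin Omega_top (near n u)" "openin Omega_top (near n u')"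
  by (intro openin_cylinder in_Omega finite_atLeastAtMost_int)+

lemma in_near: "u \<in> near n u" "u' \<in> near n u'"
  using in_Omega by (auto simp: cylinder_def)

lemma walk_closed_imp_locally_fixed:
  assumes "v \<in> N" "(walk u u' ^^ n) (0, 0, v) = (0, 0, v)"
  shows "locally_fixed n (u, u', v)"
proof -
  have "\<forall>\<eta>\<in>near n u. \<forall>\<eta>'\<in>near n u'. (Phi ^^ n) (\<eta>, \<eta>', v) = (\<eta>, \<eta>', v)"
    using Phi_funpow_near[OF assms(1)] by (simp add: assms(2) recenter_origin)
  then show ?thesis using openin_near[of n] in_near[of n] unfolding locally_fixed.simps by blast
qed

lemma locally_fixed_imp_walk_closed:
  assumes "v \<in> N" "locally_fixed n (u, u', v)"
  shows "(walk u u' ^^ n) (0, 0, v) = (0, 0, v)"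
proof -
  obtain U U' where U: "openin Omega_top U" "u \<in> U" "openin Omega_top U'" "u' \<in> U'"
    and fixed: "\<And>\<eta> \<eta>'. \<eta> \<in> U \<Longrightarrow> \<eta>' \<in> U' \<Longrightarrow> (Phi ^^ n) (\<eta>, \<eta>', v) = (\<eta>, \<eta>', v)"
    using assms(2) by auto
  obtain x y w where endpoint: "(walk u u' ^^ n) (0, 0, v) = (x, y, w)" by (metis prod.exhaust)
  let ?V = "U \<inter> near n u" and ?V' = "U' \<inter> near n u'"
  have V: "openin Omega_top ?V" "u \<in> ?V" "openin Omega_top ?V'" "u' \<in> ?V'"
    using U openin_near[of n] in_near[of n] by auto
  have translates: "(\<lambda>z. \<eta> (z + x)) = \<eta>" "(\<lambda>z. \<eta>' (z + y)) = \<eta>'" "w = v"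
    if "\<eta> \<in> ?V" "\<eta>' \<in> ?V'" for \<eta> \<eta>'
    using fixed[of \<eta> \<eta>'] Phi_funpow_near[OF assms(1), of \<eta> n \<eta>'] that
    by (simp_all add: endpoint recenter_def)
  have "x = 0" using V(1,2) translates(1)[OF _ V(4)] by (rule locally_periodic_imp_zero)
  moreover have "y = 0" using V(3,4) translates(2)[OF V(2)] by (rule locally_periodic_imp_zero)
  ultimately show ?thesis using translates(3)[OF V(2,4)] by (simp add: endpoint)
qed

lemma locally_fixed_iff:
  "v \<in> N \<Longrightarrow> locally_fixed n (u, u', v) \<longleftrightarrow> (walk u u' ^^ n) (0, 0, v) = (0, 0, v)"
  using walk_closed_imp_locally_fixed locally_fixed_imp_walk_closed by blast

lemma in_P4_iff:
  assumes "v \<in> N"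
  shows "(u, u', v) \<in> P4 \<longleftrightarrow> (walk u u' ^^ 4) (0, 0, v) = (0, 0, v)"
  using assms walk_not_closed_below_four[of "(0, 0, v)"] in_Omega
  by (auto simp: P4_def stable_period_def X_def states_def locally_fixed_iff
      simp del: locally_fixed.simps)

end

lemma locally_fixed_imp_stable_period:
  assumes "x \<in> X" "0 < n" "locally_fixed n x"
  obtains m where "m \<le> n" "stable_period x m"
proof -
  obtain m where m: "0 < m" "locally_fixed m x" "\<And>j. j < m \<Longrightarrow> \<not> (0 < j \<and> locally_fixed j x)"
    using exists_least_iff[of "\<lambda>m. 0 < m \<and> locally_fixed m x"] assms(2,3) by blast
  then have "m \<le> n" using assms(2,3) by (meson not_less)
  moreover have "stable_period x m" using m assms(1) by (auto simp: stable_period_def)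
  ultimately show thesis by (rule that)
qed

subsection \<open>Indexing the kept positions\<close>

lemma K_shift: "u \<in> Omega \<Longrightarrow> k \<in> K (\<lambda>n. u (n + x)) \<longleftrightarrow> k + x \<in> K u"
  by (simp add: in_K_iff shift_in_Omega algebra_simps)

lemma K_shift_eq_image: "u \<in> Omega \<Longrightarrow> K (\<lambda>n. u (n + x)) = (\<lambda>k. k - x) ` K u"
  by (auto simp: K_shift intro!: image_eqI[of _ _ "_ + x"])

lemma unbounded_collapsible_shift:
  assumes "u \<in> Omega" "unbounded_collapsible u"
  shows "unbounded_collapsible (\<lambda>n. u (n + x))"
proof -
  have "bdd_above (K u)" if "bdd_above (K (\<lambda>n. u (n + x)))"
    using that unfolding K_shift_eq_image[OF assms(1)]
    by (auto simp: bdd_above_def) (metis diff_le_eq)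
  moreover have "bdd_below (K u)" if "bdd_below (K (\<lambda>n. u (n + x)))"
    using that unfolding K_shift_eq_image[OF assms(1)]
    by (auto simp: bdd_below_def) (metis le_diff_eq)
  ultimately show ?thesis using assms(2) by (auto simp: unbounded_collapsible_def)
qed

lemma in_C_iff: "u \<in> C \<longleftrightarrow> u \<in> Omega \<and> unbounded_collapsible u \<and> 0 \<in> K u"
  by (simp add: C_def zero_collapsible_def)

lemma shift_in_C_iff:
  assumes "u \<in> Omega" "unbounded_collapsible u"
  shows "(\<lambda>n. u (n + x)) \<in> C \<longleftrightarrow> x \<in> K u"
  using assms by (simp add: in_C_iff shift_in_Omega unbounded_collapsible_shift K_shift)

lemma (in unbounded_pair) recenter_in_R1_iff: "recenter u u' p \<in> R1 \<longleftrightarrow> p \<in> kept u u'"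
  using in_Omega unbounded
  by (auto simp: recenter_def R1_def kept_def shift_in_C_iff split: prod.splits)

lemma K_index_eqI:
  assumes "strict_mono k" "range k = K u" "k 0 = 0"
  shows "K_index u = k"
  unfolding K_index_def using assms strict_mono_int_unique by (intro the_equality) auto

lemma K_index_enumerates:
  assumes "u \<in> C"
  shows "strict_mono (K_index u)" "range (K_index u) = K u" "K_index u 0 = 0"
proof -
  have "\<not> bdd_above (K u)" "\<not> bdd_below (K u)" "0 \<in> K u"
    using assms by (auto simp: in_C_iff unbounded_collapsible_def)
  note enum = strict_mono_enumerate_int[OF this(1,2)] range_enumerate_int[OF this] enumerate_int_0
  show "strict_mono (K_index u)" "range (K_index u) = K u" "K_index u 0 = 0"
    using enum unfolding K_index_eqI[OF enum] .
qed

lemma K_index_in_K: "u \<in> C \<Longrightarrow> K_index u i \<in> K u"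
  using K_index_enumerates(2) by blast

lemma first_return_K_index:
  assumes "u \<in> C" "a \<in> {-1, 1}"
  shows "first_return ((+) a) (K u) (K_index u i) = K_index u (i + a)"
  using first_return_range_strict_mono[OF K_index_enumerates(1) assms(2)] assms(1)
  by (simp add: K_index_enumerates(2))

lemma K_index_shift:
  assumes "u \<in> C"
  shows "K_index (\<lambda>n. u (n + K_index u i)) = (\<lambda>j. K_index u (j + i) - K_index u i)"
proof (rule K_index_eqI)
  note k = K_index_enumerates[OF assms]
  show "strict_mono (\<lambda>j. K_index u (j + i) - K_index u i)"
    using k(1) by (simp add: strict_mono_def)
  have "range (\<lambda>j. K_index u (j + i) - K_index u i) =
      (\<lambda>k. k - K_index u i) ` K_index u ` range (\<lambda>j. j + i)" by (simp only: image_image)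
  also have "\<dots> = (\<lambda>k. k - K_index u i) ` K u" by (simp add: k(2))
  finally show "range (\<lambda>j. K_index u (j + i) - K_index u i) = K (\<lambda>n. u (n + K_index u i))"
    using assms by (simp add: K_shift_eq_image in_C_iff)
qed simp

lemma collapse_shift:
  "u \<in> C \<Longrightarrow> collapse (\<lambda>n. u (n + K_index u i)) = (\<lambda>n. collapse u (n + i))"
  by (simp add: collapse_def K_index_shift)

lemma collapse_in_Omega: "u \<in> Omega \<Longrightarrow> collapse u \<in> Omega"
  by (auto simp: collapse_def Omega_iff)

subsection \<open>Renormalization\<close>

definition expand :: "seq \<Rightarrow> seq \<Rightarrow> state \<Rightarrow> state" where
  "expand u u' = (\<lambda>(i, j, v). (K_index u i, K_index u' j, v))"

locale collapsible_pair =
  fixes u u' :: seq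
  assumes in_C: "u \<in> C" "u' \<in> C"

sublocale collapsible_pair \<subseteq> unbounded_pair u u'
  using in_C by unfold_locales (auto simp: in_C_iff)

sublocale collapsible_pair \<subseteq> collapsed: sign_pair "collapse u" "collapse u'"
  using in_Omega by unfold_locales (auto intro: collapse_in_Omega)

context collapsible_pair
begin

lemma expand_origin: "expand u u' (0, 0, v) = (0, 0, v)"
  using in_C by (simp add: expand_def K_index_enumerates)

lemma expand_inject: "expand u u' p = expand u u' q \<longleftrightarrow> p = q"
  using in_C by (auto simp: expand_def strict_mono_eq K_index_enumerates split: prod.splits)

lemma expand_horizontal:
  "expand u u' (horizontal (collapse u') e i j) = horizontal u' e (K_index u i) (K_index u' j)"
  by (simp add: expand_def horizontal_def collapse_def)

lemma expand_vertical:
  "expand u u' (vertical (collapse u) e i j) = vertical u e (K_index u i) (K_index u' j)"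
  by (simp add: expand_def vertical_def collapse_def)

lemma rho_recenter_expand:
  "rho (recenter u u' (expand u u' q)) = recenter (collapse u) (collapse u') q"
  using in_C by (auto simp: recenter_def expand_def collapse_shift split: prod.splits)

lemma first_return_expand:
  assumes "q \<in> states"
  shows "first_return (walk u u') (kept u u') (expand u u' q) =
    expand u u' (walk (collapse u) (collapse u') q)"
  using assms
proof (cases rule: collapsed.statesE)
  case (horizontal e i j)
  let ?b = "e * u (K_index u i)"
  have "?b \<in> {-1, 1}" using horizontal(1) sign(1)[of "K_index u i"] by auto
  then have "first_return (walk u u') (kept u u') (expand u u' q) =
      vertical u e (K_index u i) (K_index u' (j + ?b))"
    using horizontal in_C
    by (simp add: expand_horizontal first_return_horizontal K_index_in_K first_return_K_index)
  also have "\<dots> = expand u u' (walk (collapse u) (collapse u') q)"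
    unfolding horizontal(2) collapsed.walk_horizontal expand_vertical by (simp add: collapse_def)
  finally show ?thesis .
next
  case (vertical e i j)
  let ?a = "e * u' (K_index u' j)"
  have "?a \<in> {-1, 1}" using vertical(1) sign(2)[of "K_index u' j"] by auto
  then have "first_return (walk u u') (kept u u') (expand u u' q) =
      horizontal u' e (K_index u (i + ?a)) (K_index u' j)"
    using vertical in_C
    by (simp add: expand_vertical first_return_vertical K_index_in_K first_return_K_index)
  also have "\<dots> = expand u u' (walk (collapse u) (collapse u') q)"
    unfolding vertical(2) collapsed.walk_vertical expand_horizontal by (simp add: collapse_def)
  finally show ?thesis .
qed

lemma first_return_funpow_expand:
  assumes "q \<in> states"
  shows "(first_return (walk u u') (kept u u') ^^ m) (expand u u' q) =
    expand u u' ((walk (collapse u) (collapse u') ^^ m) q)"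
  by (induction m)
    (simp_all add: first_return_expand collapsed.walk_funpow_in_states[OF assms])

lemma collapsed_walk_closes_earlier:
  assumes "v \<in> N" "0 < n" "(walk u u' ^^ n) (0, 0, v) = (0, 0, v)"
  shows "\<exists>m>0. m < n \<and> (walk (collapse u) (collapse u') ^^ m) (0, 0, v) = (0, 0, v)"
proof -
  let ?origin = "(0, 0, v) :: state"
  have "?origin \<in> kept u u'" using in_C assms(1) by (simp add: kept_def in_C_iff)
  moreover obtain i where "(walk u u' ^^ i) ?origin \<notin> kept u u'"
    using kept_orbit_not_closed assms(2,3) by blast
  ultimately obtain m where m: "0 < m" "m < n"
    "(first_return (walk u u') (kept u u') ^^ m) ?origin = ?origin"
    using first_return_closed_orbit[of ?origin "kept u u'" n "walk u u'" i] assms(2,3) by blast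
  have "?origin \<in> states" using assms(1) by (simp add: states_def)
  from first_return_funpow_expand[OF this, of m]
  have "expand u u' ((walk (collapse u) (collapse u') ^^ m) ?origin) = expand u u' ?origin"
    by (simp add: expand_origin m(3))
  then show ?thesis using m(1,2) by (auto simp: expand_inject)
qed

end

lemma (in unbounded_pair) Phi_R_recenter:
  "Phi_R (recenter u u' p) = recenter u u' (first_return (walk u u') (kept u u') p)"
  by (simp add: Phi_R_def first_return_def Phi_funpow_recenter recenter_in_R1_iff)

lemma R1E:
  assumes "x \<in> R1"
  obtains (point) u u' v where "x = (u, u', v)" "collapsible_pair u u'" "v \<in> N"
  using assms by (auto simp: R1_def collapsible_pair_def)

lemma P4_disjoint_R1: "P4 \<inter> R1 = {}"
proof -
  have "x \<notin> P4" if "x \<in> R1" for x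
    using that
  proof (cases rule: R1E)
    case (point u u' v)
    then interpret collapsible_pair u u' by simp
    have "(0, 0, v) \<in> kept u u'" using in_C point(3) by (simp add: kept_def in_C_iff)
    then show ?thesis using kept_not_four_step_loop point in_P4_iff by simp
  qed
  then show ?thesis by blast
qed

lemma R1_subset: "R1 \<subseteq> X - (P4 \<union> NUC)"
  using P4_disjoint_R1 by (auto simp: R1_def X_def NUC_def in_C_iff)

lemma visits_R1:
  assumes "x \<in> X - (P4 \<union> NUC)"
  shows "\<exists>n>0. (Phi ^^ n) x \<in> R1" "\<exists>n>0. \<exists>z\<in>R1. (Phi ^^ n) z = x"
proof -
  obtain u u' v where x: "x = (u, u', v)" and v: "v \<in> N" and "unbounded_pair u u'"
    using assms
    by (auto simp: X_def NUC_def unbounded_pair_def sign_pair_def unbounded_pair_axioms_def)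
  then interpret unbounded_pair u u' by simp
  let ?origin = "(0, 0, v) :: state"
  have origin: "?origin \<in> states" "(walk u u' ^^ 4) ?origin \<noteq> ?origin"
    using assms v by (auto simp: x states_def in_P4_iff)
  have x_recenter: "x = recenter u u' ?origin" by (simp add: x recenter_origin)
  show "\<exists>n>0. (Phi ^^ n) x \<in> R1"
    using walk_returns_to_kept[OF origin]
    by (simp add: x_recenter Phi_funpow_recenter recenter_in_R1_iff)
  obtain n q where "0 < n" "q \<in> kept u u'" "(walk u u' ^^ n) q = ?origin"
    using walk_comes_from_kept[OF origin] by blast
  then show "\<exists>n>0. \<exists>z\<in>R1. (Phi ^^ n) z = x"
    using Phi_funpow_recenter[of n q] recenter_in_R1_iff[of q] x_recenter by metis
qed

lemma int_iter_of_nat: "int_iter A f (int n) x = (f ^^ n) x"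
  by (simp add: int_iter_def)

lemma int_iter_uminus_of_nat:
  assumes "bij_betw f A A" "z \<in> A"
  shows "int_iter A f (- int n) ((f ^^ n) z) = z"
proof -
  have "(inv_into A f ^^ n) ((f ^^ n) z) = z"
    using assms(2)
  proof (induction n arbitrary: z)
    case (Suc n)
    have "f z \<in> A" "inv_into A f (f z) = z"
      using assms(1) Suc.prems by (auto simp: bij_betw_def)
    then show ?case using Suc.IH by (simp add: funpow_swap1)
  qed simp
  then show ?thesis by (cases "n = 0") (auto simp: int_iter_def)
qed

lemma Phi_pow_visits_R1:
  assumes "x \<in> X - (P4 \<union> NUC)"
  shows "\<exists>m n :: int. m < 0 \<and> 0 < n \<and> Phi_pow m x \<in> R1 \<and> Phi_pow n x \<in> R1"
proof -
  obtain n where n: "0 < n" "(Phi ^^ n) x \<in> R1" using visits_R1(1)[OF assms] by blast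
  obtain m z where m: "0 < m" "z \<in> R1" "(Phi ^^ m) z = x" using visits_R1(2)[OF assms] by blast
  have "Phi_pow (- int m) x = z"
    using int_iter_uminus_of_nat[OF bij_betw_Phi] R1_subset m(2,3) by blast
  then show ?thesis
    using n m by (intro exI[of _ "- int m"] exI[of _ "int n"]) (simp add: int_iter_of_nat)
qed

lemma bij_betw_Phi_R: "bij_betw Phi_R R1 R1"
proof -
  have "bij_betw (first_return Phi R1) R1 R1"
    by (rule bij_betw_first_return[OF bij_betw_Phi]) (use visits_R1 R1_subset in blast)+
  moreover have "Phi_R = first_return Phi R1" by (simp add: fun_eq_iff Phi_R_def first_return_def)
  ultimately show ?thesis by simp
qed

lemma rho_Phi_R:
  assumes "x \<in> R1"
  shows "rho (Phi_R x) = Phi (rho x)"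
  using assms
proof (cases rule: R1E)
  case (point u u' v)
  then interpret collapsible_pair u u' by simp
  let ?origin = "(0, 0, v) :: state"
  have "?origin \<in> states" using point(3) by (simp add: states_def)
  then have "Phi_R x = recenter u u' (expand u u' (walk (collapse u) (collapse u') ?origin))"
    using Phi_R_recenter[of ?origin] first_return_expand[of ?origin]
    by (simp add: point(1) recenter_origin expand_origin)
  then have "rho (Phi_R x) =
      recenter (collapse u) (collapse u') (walk (collapse u) (collapse u') ?origin)"
    by (simp only: rho_recenter_expand)
  also have "\<dots> = Phi (recenter (collapse u) (collapse u') ?origin)"
    by (rule collapsed.Phi_recenter[symmetric])
  finally show ?thesis by (simp add: point(1) recenter_origin)
qed

lemma rho_decreases_stable_period:
  assumes "x \<in> R1" "stable_period x n"
  shows "\<exists>m<n. stable_period (rho x) m"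
  using assms(1)
proof (cases rule: R1E)
  case (point u u' v)
  then interpret collapsible_pair u u' by simp
  have "0 < n" "(walk u u' ^^ n) (0, 0, v) = (0, 0, v)"
    using assms(2) locally_fixed_iff[OF point(3)] by (auto simp: point(1) stable_period_def)
  then obtain l where l: "0 < l" "l < n"
    "(walk (collapse u) (collapse u') ^^ l) (0, 0, v) = (0, 0, v)"
    using collapsed_walk_closes_earlier point(3) by blast
  then have "locally_fixed l (rho x)"
    using collapsed.locally_fixed_iff[OF point(3)] by (simp add: point(1))
  moreover have "rho x \<in> X" using collapsed.in_Omega point(3) by (simp add: point(1) X_def)
  ultimately obtain m where "m \<le> l" "stable_period (rho x) m"
    using locally_fixed_imp_stable_period l(1) by blast
  then show ?thesis using l(2) by (meson le_less_trans)
qed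

theorem theorem19:
  "P4 \<inter> R1 = {} \<and>
   (\<forall>x \<in> X - (P4 \<union> NUC).
      \<exists>m n :: int. m < 0 \<and> 0 < n \<and> Phi_pow m x \<in> R1 \<and> Phi_pow n x \<in> R1) \<and>
   (\<forall>x \<in> R1. \<exists>n > 0. (Phi ^^ n) x \<in> R1) \<and>
   bij_betw Phi_R R1 R1 \<and>
   (\<forall>x \<in> R1. rho (Phi_R x) = Phi (rho x)) \<and>
   (\<forall>x \<in> R1. \<forall>n > 4. stable_period x n \<longrightarrow> (\<exists>m < n. stable_period (rho x) m))"
proof (intro conjI ballI allI impI)
  show "P4 \<inter> R1 = {}" by (rule P4_disjoint_R1)
  show "\<exists>m n :: int. m < 0 \<and> 0 < n \<and> Phi_pow m x \<in> R1 \<and> Phi_pow n x \<in> R1"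
    if "x \<in> X - (P4 \<union> NUC)" for x
    using that by (rule Phi_pow_visits_R1)
  show "\<exists>n>0. (Phi ^^ n) x \<in> R1" if "x \<in> R1" for x
    using visits_R1(1) R1_subset that by blast
  show "bij_betw Phi_R R1 R1" by (rule bij_betw_Phi_R)
  show "rho (Phi_R x) = Phi (rho x)" if "x \<in> R1" for x using that by (rule rho_Phi_R)
  show "\<exists>m<n. stable_period (rho x) m" if "x \<in> R1" "4 < n" "stable_period x n" for x n
    using that(1,3) by (rule rho_decreases_stable_period)
qed

end
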